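(* Assume that there exist a family $\{\kappa_\epsilon\}_{\epsilon}$ of strictly positive constants and a Borel measurable function $\bar w:\Theta\to\mathbb R_+$, $\pi$-integrable and not $\pi$-almost surely equal to zero, such that $$\lim_{\epsilon\downarrow 0}\int_\Theta\left|\frac{1}{\kappa_\epsilon}w_\epsilon(\theta)-\bar w(\theta)\right|\pi(d\theta)=0 .$$ Then, as $\epsilon\downarrow0$, the family of probability measures $\{\pi_\epsilon\}_\epsilon$ converges in total variation to the probability measure $\bar\pi\in\mathscr P(\Theta)$ defined by $$\bar\pi[B]:=\frac{\int_B\bar w(\theta)\,\pi(d\theta)}{\int_\Theta\bar w(\theta')\,\pi(d\theta')},\qquad B\in\mathcal B(\Theta),$$ that is, $$\lim_{\epsilon\downarrow0}\ \sup_{B\in\mathcal B(\Theta)}\big|\pi_\epsilon[B]-\bar\pi[B]\big|=0 .$$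
   Context: $\Theta\subseteq\mathbb R^{m_\Theta}$ is endowed with the topology induced by a metric $d_\Theta$; $\mathcal B(\Theta)$ is its Borel $\sigma$-algebra and $\mathscr P(\Theta)$ the set of probability measures on $\mathcal B(\Theta)$. $\mathbb R_+=[0,\infty)$. $\pi\in\mathscr P(\Theta)$ is a fixed probability measure (the prior). $\{w_\epsilon\}_{\epsilon\in(0,\infty)}$ is a family of Borel measurable functions $w_\epsilon:\Theta\to\mathbb R_+$ (compatibility weights) such that, for every sufficiently small $\epsilon$, $w_\epsilon$ is $\pi$-integrable and not $\pi$-almost surely equal to zero. For such $\epsilon$, the probability measure $\pi_\epsilon\in\mathscr P(\Theta)$ is defined by $$\pi_\epsilon[B]:=\frac{\int_B w_\epsilon(\theta)\,\pi(d\theta)}{\int_\Theta w_\epsilon(\theta')\,\pi(d\theta')},\qquad B\in\mathcal B(\Theta).$$ *)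

theory Defs
  imports "HOL-Analysis.Analysis" "HOL-Probability.Probability"
begin

text \<open>
  The Borel sigma-algebra of the metric space \<open>(\<Theta>, d)\<close>, as a measure space whose measure is
  irrelevant.  The metric \<open>d\<close> need not induce the Euclidean topology on \<open>\<Theta>\<close>, so
  \<open>restrict_space borel \<Theta>\<close> would be too special.
\<close>
definition metric_borel :: "'a set \<Rightarrow> ('a \<Rightarrow> 'a \<Rightarrow> real) \<Rightarrow> 'a measure" where
  "metric_borel \<Theta> d = sigma \<Theta> {U. openin (Metric_space.mtopology \<Theta> d) U}"

definition prob_measures_on :: "'a set \<Rightarrow> ('a \<Rightarrow> 'a \<Rightarrow> real) \<Rightarrow> 'a measure set" where
  "prob_measures_on \<Theta> d = {M. sets M = sets (metric_borel \<Theta> d) \<and> prob_space M}"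

text \<open>
  Meaningful when \<open>w\<close> is nonnegative, integrable and not almost surely zero with respect to \<open>M\<close>;
  when the set function below is not a measure, \<^const>\<open>measure_of\<close> yields the zero measure.
\<close>
definition weighted_prob :: "'a measure \<Rightarrow> ('a \<Rightarrow> real) \<Rightarrow> 'a measure" where
  "weighted_prob M w = measure_of (space M) (sets M)
     (\<lambda>B. ennreal ((LINT \<theta>:B|M. w \<theta>) / (LINT \<theta>|M. w \<theta>)))"

end

theory Submission
  imports Defs
begin

text \<open>Normalising a weight cancels any positive factor, so \<open>w \<epsilon>\<close> may be
  replaced by u = \<open>w \<epsilon>\<close> / \<open>\<kappa> \<epsilon>\<close> without changing
  the probability measure (\<open>weighted_prob_scale\<close>); this u converges to v =
  \<open>wbar\<close> in L1 of the prior. Let D be the L1 distance of u and v. The unnormalised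
  masses of any measurable set under u and v differ by at most D, and so do the total masses. Hence
  the normalised masses differ by at most 2 * D divided by the integral of v
  (\<open>measure_weighted_prob_diff_le\<close>). This bound does not depend on the set, so it
  survives the supremum, and its denominator is a fixed positive number, so it tends to 0 with D.

  The remaining lemmas show that the quotient of integrals really is a probability measure, by
  identifying it with a density.\<close>

lemma space_prob_measures_on:
  assumes "M \<in> prob_measures_on \<Theta> d"
  shows "space M = \<Theta>"
proof -
  have "space M = space (metric_borel \<Theta> d)"
    using assms sets_eq_imp_space_eq unfolding prob_measures_on_def by blast
  then show ?thesis
    by (simp add: metric_borel_def space_measure_of_conv)
qed

text \<open>A nonnegative integrable function with integral zero vanishes almost everywhere. This
  keeps every normalising denominator away from zero.\<close>

lemma integral_pos:
  fixes w :: "'a \<Rightarrow> real"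
  assumes int: "integrable M w"
    and nonneg: "\<And>x. x \<in> space M \<Longrightarrow> 0 \<le> w x"
    and nonzero: "\<not> (AE x in M. w x = 0)"
  shows "0 < (LINT x|M. w x)"
proof -
  have AE: "AE x in M. 0 \<le> w x"
    using nonneg by simp
  then have "0 \<le> (LINT x|M. w x)"
    by (rule integral_nonneg_AE)
  moreover have "(LINT x|M. w x) \<noteq> 0"
    using integral_nonneg_eq_0_iff_AE[OF int AE] nonzero by simp
  ultimately show ?thesis by simp
qed

text \<open>Used twice in the main estimate: for a weight, to see that a normalised mass is at most
  1, and for the absolute difference of two weights, to make the bound uniform over measurable
  sets.\<close>

lemma set_integral_nonneg_le_integral:
  fixes w :: "'a \<Rightarrow> real"
  assumes int: "integrable M w"
    and nonneg: "\<And>x. x \<in> space M \<Longrightarrow> 0 \<le> w x"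
    and B: "B \<in> sets M"
  shows "0 \<le> (LINT x:B|M. w x)" and "(LINT x:B|M. w x) \<le> (LINT x|M. w x)"
proof -
  show "0 \<le> (LINT x:B|M. w x)"
    unfolding set_lebesgue_integral_def
    using nonneg by (intro Bochner_Integration.integral_nonneg) simp
  have "integrable M (\<lambda>x. indicator B x *\<^sub>R w x)"
    using integrable_mult_indicator[OF B int] .
  then show "(LINT x:B|M. w x) \<le> (LINT x|M. w x)"
    unfolding set_lebesgue_integral_def
    using int nonneg by (intro integral_mono) (auto split: split_indicator)
qed

lemma nn_integral_normalised_weight:
  fixes w :: "'a \<Rightarrow> real"
  assumes int: "integrable M w"
    and nonneg: "\<And>x. x \<in> space M \<Longrightarrow> 0 \<le> w x"
    and nonzero: "\<not> (AE x in M. w x = 0)"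
    and B: "B \<in> sets M"
  shows "(\<integral>\<^sup>+ x. ennreal (w x / (LINT x|M. w x)) * indicator B x \<partial>M)
    = ennreal ((LINT x:B|M. w x) / (LINT x|M. w x))"
proof -
  define c where "c = (LINT x|M. w x)"
  have c: "0 < c"
    unfolding c_def using int nonneg nonzero by (rule integral_pos)
  have "integrable M (\<lambda>x. indicator B x * w x)"
    using integrable_mult_indicator[OF B int] by simp
  then have "(\<integral>\<^sup>+ x. ennreal (indicator B x * w x / c) \<partial>M)
      = ennreal (LINT x|M. indicator B x * w x / c)"
    using c nonneg by (intro nn_integral_eq_integral) auto
  moreover have "(\<integral>\<^sup>+ x. ennreal (w x / c) * indicator B x \<partial>M)
      = (\<integral>\<^sup>+ x. ennreal (indicator B x * w x / c) \<partial>M)"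
    by (intro nn_integral_cong) (simp split: split_indicator)
  ultimately show ?thesis
    by (simp add: set_lebesgue_integral_def c_def)
qed

text \<open>A density is countably additive by construction, which spares checking this for the
  quotient of Bochner integrals. Both sides are built by \<open>measure_of\<close> on the same space
  and sets, so agreement of the two set functions on \<open>sets M\<close> suffices.\<close>

lemma weighted_prob_eq_density:
  assumes "integrable M w"
    and "\<And>x. x \<in> space M \<Longrightarrow> 0 \<le> w x"
    and "\<not> (AE x in M. w x = 0)"
  shows "weighted_prob M w = density M (\<lambda>x. ennreal (w x / (LINT x|M. w x)))"
  unfolding weighted_prob_def density_def
  using nn_integral_normalised_weight[of M w] assms
  by (intro measure_of_eq sets.space_closed) (simp add: sets.sigma_sets_eq)

lemma emeasure_weighted_prob:
  assumes int: "integrable M w"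
    and nonneg: "\<And>x. x \<in> space M \<Longrightarrow> 0 \<le> w x"
    and nonzero: "\<not> (AE x in M. w x = 0)"
    and B: "B \<in> sets M"
  shows "emeasure (weighted_prob M w) B = ennreal ((LINT x:B|M. w x) / (LINT x|M. w x))"
proof -
  have "weighted_prob M w = density M (\<lambda>x. ennreal (w x / (LINT x|M. w x)))"
    using int nonneg nonzero by (rule weighted_prob_eq_density)
  moreover have "(\<lambda>x. ennreal (w x / (LINT x|M. w x))) \<in> borel_measurable M"
    using int by measurable
  ultimately show ?thesis
    using nn_integral_normalised_weight[of M w B] assms by (simp add: emeasure_density)
qed

lemma measure_weighted_prob:
  assumes int: "integrable M w"
    and nonneg: "\<And>x. x \<in> space M \<Longrightarrow> 0 \<le> w x"
    and nonzero: "\<not> (AE x in M. w x = 0)"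
    and B: "B \<in> sets M"
  shows "measure (weighted_prob M w) B = (LINT x:B|M. w x) / (LINT x|M. w x)"
proof -
  \<comment> \<open>\<open>ennreal\<close> sends negative reals to 0, so the sign of the quotient
    must be known before passing back from \<open>emeasure\<close> to the real-valued
    \<open>measure\<close>.\<close>
  have "0 \<le> (LINT x:B|M. w x) / (LINT x|M. w x)"
    using integral_pos[of M w] set_integral_nonneg_le_integral(1)[of M w B] assms by simp
  then show ?thesis
    using emeasure_weighted_prob[of M w B] assms by (simp add: measure_def)
qed

lemma sets_weighted_prob: "sets (weighted_prob M w) = sets M"
  by (simp add: weighted_prob_def)

lemma prob_space_weighted_prob:
  assumes int: "integrable M w"
    and nonneg: "\<And>x. x \<in> space M \<Longrightarrow> 0 \<le> w x"
    and nonzero: "\<not> (AE x in M. w x = 0)"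
  shows "prob_space (weighted_prob M w)"
proof -
  have "space (weighted_prob M w) = space M"
    using sets_weighted_prob by (rule sets_eq_imp_space_eq)
  \<comment> \<open>On the whole space numerator and denominator coincide, so the total mass is
    1.\<close>
  moreover have "(LINT x:space M|M. w x) = (LINT x|M. w x)"
    using int by (rule set_integral_space)
  ultimately show ?thesis
    using emeasure_weighted_prob[of M w "space M"] integral_pos[of M w] assms
    by (intro prob_spaceI) simp
qed

lemma weighted_prob_in_prob_measures_on:
  assumes "M \<in> prob_measures_on \<Theta> d" "integrable M w"
    and "\<And>x. x \<in> \<Theta> \<Longrightarrow> 0 \<le> w x" "\<not> (AE x in M. w x = 0)"
  shows "weighted_prob M w \<in> prob_measures_on \<Theta> d"
  using assms prob_space_weighted_prob[of M w] space_prob_measures_on[OF assms(1)]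
  by (simp add: prob_measures_on_def sets_weighted_prob)

lemma weighted_prob_scale:
  assumes "c \<noteq> 0"
  shows "weighted_prob M (\<lambda>x. c * w x) = weighted_prob M w"
  using assms by (simp add: weighted_prob_def)

text \<open>
  With \<open>U, V\<close> the total masses and \<open>U\<^sub>B, V\<^sub>B\<close> the masses of \<open>B\<close>, the difference is
  \<open>(U\<^sub>B - V\<^sub>B) / V + (U\<^sub>B / U) * (V - U) / V\<close>, where \<open>U\<^sub>B / U \<le> 1\<close>.
\<close>
lemma measure_weighted_prob_diff_le:
  assumes u: "integrable M u" "\<And>x. x \<in> space M \<Longrightarrow> 0 \<le> u x" "\<not> (AE x in M. u x = 0)"
    and v: "integrable M v" "\<And>x. x \<in> space M \<Longrightarrow> 0 \<le> v x" "\<not> (AE x in M. v x = 0)"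
    and B: "B \<in> sets M"
  shows "\<bar>measure (weighted_prob M u) B - measure (weighted_prob M v) B\<bar>
    \<le> 2 * (LINT x|M. \<bar>u x - v x\<bar>) / (LINT x|M. v x)"
proof -
  define U V D where "U = (LINT x|M. u x)" and "V = (LINT x|M. v x)"
    and "D = (LINT x|M. \<bar>u x - v x\<bar>)"
  define UB VB where "UB = (LINT x:B|M. u x)" and "VB = (LINT x:B|M. v x)"
  have pos: "0 < U" "0 < V"
    unfolding U_def V_def using integral_pos u v by blast+
  have UB: "0 \<le> UB" "UB \<le> U"
    unfolding U_def UB_def using set_integral_nonneg_le_integral[OF u(1,2) B] by simp_all
  have "\<bar>V - U\<bar> \<le> D"
    using integral_abs_bound[of M "\<lambda>x. u x - v x"] u(1) v(1)
    by (simp add: U_def V_def D_def abs_minus_commute)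
  have "set_integrable M B u" "set_integrable M B v"
    unfolding set_integrable_def using integrable_mult_indicator[OF B] u(1) v(1) by blast+
  then have "\<bar>UB - VB\<bar> = \<bar>LINT x:B|M. u x - v x\<bar>"
    by (simp add: UB_def VB_def set_integral_diff)
  also have "\<dots> \<le> (LINT x:B|M. \<bar>u x - v x\<bar>)"
    unfolding set_lebesgue_integral_def
    using integral_abs_bound[of M "\<lambda>x. indicator B x *\<^sub>R (u x - v x)"] by (simp add: abs_mult)
  also have "\<dots> \<le> D"
    \<comment> \<open>Here \<bar>u - v\<bar> itself plays the role of the nonnegative
      weight.\<close>
    unfolding D_def using u(1) v(1) B by (intro set_integral_nonneg_le_integral(2)) auto
  finally have "\<bar>UB - VB\<bar> \<le> D" .
  \<comment> \<open>The factor 1 bounds \<open>UB / U\<close>; it is written out so that the product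
    can be estimated factor by factor.\<close>
  have "\<bar>UB / U * (V - U)\<bar> \<le> 1 * D"
    unfolding abs_mult using pos UB \<open>\<bar>V - U\<bar> \<le> D\<close> by (intro mult_mono) auto
  have "\<bar>UB / U - VB / V\<bar> = \<bar>(UB - VB) + UB / U * (V - U)\<bar> / V"
  proof -
    have "UB / U - VB / V = ((UB - VB) + UB / U * (V - U)) / V"
      using pos by (simp add: field_simps)
    then show ?thesis using pos by (simp add: abs_divide)
  qed
  also have "\<dots> \<le> 2 * D / V"
    using pos \<open>\<bar>UB - VB\<bar> \<le> D\<close> \<open>\<bar>UB / U * (V - U)\<bar> \<le> 1 * D\<close>
    by (intro divide_right_mono) linarith+
  finally show ?thesis
    using measure_weighted_prob[OF u B] measure_weighted_prob[OF v B]
    by (simp add: U_def V_def D_def UB_def VB_def)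
qed

theorem proposition2p1:
  fixes \<Theta> :: "(real ^ 'm) set"
    and d :: "real ^ 'm \<Rightarrow> real ^ 'm \<Rightarrow> real"
    and \<pi> :: "(real ^ 'm) measure"
    and w :: "real \<Rightarrow> real ^ 'm \<Rightarrow> real"
    and \<kappa> :: "real \<Rightarrow> real"
    and wbar :: "real ^ 'm \<Rightarrow> real"
  assumes metric: "Metric_space \<Theta> d"
    and prior: "\<pi> \<in> prob_measures_on \<Theta> d"
    and w_meas: "\<And>\<epsilon>. \<epsilon> > 0 \<Longrightarrow> w \<epsilon> \<in> borel_measurable (metric_borel \<Theta> d)"
    and w_nonneg: "\<And>\<epsilon> \<theta>. \<epsilon> > 0 \<Longrightarrow> \<theta> \<in> \<Theta> \<Longrightarrow> 0 \<le> w \<epsilon> \<theta>"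
    and w_small: "\<forall>\<^sub>F \<epsilon> in at_right 0. integrable \<pi> (w \<epsilon>) \<and> \<not> (AE \<theta> in \<pi>. w \<epsilon> \<theta> = 0)"
    and \<kappa>_pos: "\<And>\<epsilon>. \<epsilon> > 0 \<Longrightarrow> \<kappa> \<epsilon> > 0"
    and wbar_meas: "wbar \<in> borel_measurable (metric_borel \<Theta> d)"
    and wbar_nonneg: "\<And>\<theta>. \<theta> \<in> \<Theta> \<Longrightarrow> 0 \<le> wbar \<theta>"
    and wbar_int: "integrable \<pi> wbar"
    and wbar_nonzero: "\<not> (AE \<theta> in \<pi>. wbar \<theta> = 0)"
    and lim: "((\<lambda>\<epsilon>. LINT \<theta>|\<pi>. \<bar>1 / \<kappa> \<epsilon> * w \<epsilon> \<theta> - wbar \<theta>\<bar>) \<longlongrightarrow> 0) (at_right 0)"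
  shows "(\<forall>\<^sub>F \<epsilon> in at_right 0. weighted_prob \<pi> (w \<epsilon>) \<in> prob_measures_on \<Theta> d)
    \<and> weighted_prob \<pi> wbar \<in> prob_measures_on \<Theta> d
    \<and> ((\<lambda>\<epsilon>. SUP B\<in>sets (metric_borel \<Theta> d).
            \<bar>measure (weighted_prob \<pi> (w \<epsilon>)) B - measure (weighted_prob \<pi> wbar) B\<bar>)
         \<longlongrightarrow> 0) (at_right 0)"
proof (intro conjI)
  let ?W = "\<lambda>\<epsilon>. weighted_prob \<pi> (w \<epsilon>)" and ?Wbar = "weighted_prob \<pi> wbar"
  let ?\<A> = "sets (metric_borel \<Theta> d)"
  let ?TV = "\<lambda>\<epsilon>. SUP B\<in>?\<A>. \<bar>measure (?W \<epsilon>) B - measure ?Wbar B\<bar>"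
  let ?bound = "\<lambda>\<epsilon>. 2 * (LINT \<theta>|\<pi>. \<bar>1 / \<kappa> \<epsilon> * w \<epsilon> \<theta> - wbar \<theta>\<bar>) / (LINT \<theta>|\<pi>. wbar \<theta>)"
  \<comment> \<open>Nonnegativity is assumed on \<Theta>, while the general lemmas ask for it on the
    space of the measure.\<close>
  note space = space_prob_measures_on[OF prior]
  have sets: "sets \<pi> = ?\<A>"
    using prior by (simp add: prob_measures_on_def)
  \<comment> \<open>The sign conditions on the weights and on \<kappa> are given for positive
    \<epsilon> only.\<close>
  have pos: "\<forall>\<^sub>F \<epsilon> in at_right 0. (0::real) < \<epsilon>"
    by (rule eventually_at_right_less)
  show "\<forall>\<^sub>F \<epsilon> in at_right 0. ?W \<epsilon> \<in> prob_measures_on \<Theta> d"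
    using w_small pos
    by eventually_elim (use w_nonneg in \<open>blast intro: weighted_prob_in_prob_measures_on[OF prior]\<close>)
  show "?Wbar \<in> prob_measures_on \<Theta> d"
    using prior wbar_int wbar_nonneg wbar_nonzero by (rule weighted_prob_in_prob_measures_on)
  have "\<forall>\<^sub>F \<epsilon> in at_right 0. 0 \<le> ?TV \<epsilon> \<and> ?TV \<epsilon> \<le> ?bound \<epsilon>"
    using w_small pos
  proof eventually_elim
    case (elim \<epsilon>)
    let ?u = "\<lambda>\<theta>. 1 / \<kappa> \<epsilon> * w \<epsilon> \<theta>"
    have \<kappa>: "0 < \<kappa> \<epsilon>"
      using \<kappa>_pos elim by blast
    have u: "integrable \<pi> ?u" "\<And>\<theta>. \<theta> \<in> space \<pi> \<Longrightarrow> 0 \<le> ?u \<theta>" "\<not> (AE \<theta> in \<pi>. ?u \<theta> = 0)"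
      using elim \<kappa> w_nonneg space by auto
    have v: "\<And>\<theta>. \<theta> \<in> space \<pi> \<Longrightarrow> 0 \<le> wbar \<theta>"
      using wbar_nonneg space by blast
    \<comment> \<open>It is the rescaled weight, not \<open>w \<epsilon>\<close> itself, that is
      close to \<open>wbar\<close> in L1.\<close>
    have eq: "?W \<epsilon> = weighted_prob \<pi> ?u"
      using weighted_prob_scale[of "1 / \<kappa> \<epsilon>" \<pi> "w \<epsilon>"] \<kappa> by simp
    have le: "\<bar>measure (?W \<epsilon>) B - measure ?Wbar B\<bar> \<le> ?bound \<epsilon>" if "B \<in> ?\<A>" for B
      unfolding eq using measure_weighted_prob_diff_le[OF u wbar_int v wbar_nonzero] that sets
      by blast
    \<comment> \<open>A real supremum can be estimated only over a nonempty family that is bounded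
      above; the empty set serves as a member, and its term bounds the supremum below by 0.\<close>
    have "{} \<in> ?\<A>" by simp
    moreover have "bdd_above ((\<lambda>B. \<bar>measure (?W \<epsilon>) B - measure ?Wbar B\<bar>) ` ?\<A>)"
      using le by (rule bdd_aboveI2)
    ultimately have "0 \<le> ?TV \<epsilon>"
      by (intro cSUP_upper2[of _ _ "{}"]) auto
    moreover have "?TV \<epsilon> \<le> ?bound \<epsilon>"
      using le by (intro cSUP_least) auto
    ultimately show ?case ..
  qed
  then have "\<forall>\<^sub>F \<epsilon> in at_right 0. 0 \<le> ?TV \<epsilon>" "\<forall>\<^sub>F \<epsilon> in at_right 0. ?TV \<epsilon> \<le> ?bound \<epsilon>"
    by (auto elim: eventually_mono)
  moreover have "(?bound \<longlongrightarrow> 0) (at_right 0)"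
    using tendsto_divide_zero[OF tendsto_mult_right_zero[OF lim, of 2]] .
  ultimately show "(?TV \<longlongrightarrow> 0) (at_right 0)"
    by (rule tendsto_sandwich[OF _ _ tendsto_const])
qed

end
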